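(* Suppose $\mathcal{A}$ is a finitely bicomplete preorder. Let $\mathcal{F},\mathcal{C}$ be subsets of $\mathcal{A}$. Then there exists a strong model structure on $\mathcal{A}$ whose fibrant objects are precisely the members of $\mathcal{F}$, and whose cofibrant objects are precisely the members of $\mathcal{C}$, if and only if all of the following conditions are satisfied: 1. $\mathcal{F}$ and $\mathcal{C}$ are each closed under isomorphism in $\mathcal{A}$. 2. For each $x\in\mathcal{A}$, the set of upper bounds for $x$ which lie in $\mathcal{F}$ has a least element. 3. For each $x\in\mathcal{A}$, the set of lower bounds for $x$ which lie in $\mathcal{C}$ has a greatest element. 4. If $x\in\mathcal{A}$, $f\in\mathcal{F}$ and $c\in\mathcal{C}$ are such that $f$ is minimal among members of $\mathcal{F}$ which are greater than or equal to every lower bound for $x$ in $\mathcal{C}$, and $c$ is maximal among members of $\mathcal{C}$ which are less than or equal to every upper bound for $x$ in $\mathcal{F}$, then $f\cong c$, i.e., $f\leq c\leq f$. 5. If $x,y\in\mathcal{A}$ are such that $x$ is less than or equal to some lower bound for $y$ in $\mathcal{C}$, and $y$ is greater than or equal to some upper bound for $x$ in $\mathcal{F}$, then some upper bound for $x$ in $\mathcal{F}$ is less than or equal to some lower bound for $y$ in $\mathcal{C}$. 6. If $a\leq b$, and every lower bound for $b$ in $\mathcal{C}$ is also a lower bound for $a$, and every upper bound for $a$ in $\mathcal{F}$ is also an upper bound for $b$, then $b\leq a$. Furthermore, there is a bijection between strong model structures on $\mathcal{A}$ and pairs of subsets $(\mathcal{F},\mathcal{C})$ of $\mathcal{A}$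 satisfying conditions 1, 2, 3, 4, 5 and 6.
   Context: A preorder (a set with a reflexive transitive relation $\leq$) is regarded as a small category with exactly one morphism $X\to Y$ if $X\leq Y$ and none otherwise; $X\cong Y$ means $X\leq Y\leq X$. Finitely bicomplete means having all finite limits and colimits; $0$ and $1$ denote an initial and a terminal object. An upper bound for $x$ is an element $y$ with $x\leq y$; a lower bound for $x$ is an element $y$ with $y\leq x$. Least, greatest, minimal and maximal elements are understood up to isomorphism. A weak factorization system is a pair $(\mathcal{L},\mathcal{R})$ of classes of morphisms such that every morphism factors as a map in $\mathcal{L}$ followed by a map in $\mathcal{R}$, $\mathcal{L}$ is the class of maps with the left lifting property with respect to $\mathcal{R}$, and $\mathcal{R}$ is the class of maps with the right lifting property with respect to $\mathcal{L}$. A model structure is a triple $(\mathrm{cof},\mathrm{we},\mathrm{fib})$ of retract-closed subcategories containing all objects (cofibrations, weak equivalences, fibrations) such that $(\mathrm{cof}\cap \mathrm{we},\mathrm{fib})$ and $(\mathrm{cof},\mathrm{we}\cap \mathrm{fib})$ are weak factorization systems and $\mathrm{we}$ has the two-out-of-three property. Acyclic (co)fibrations are (co)fibrations which are weak equivalences. An object $X$ is fibrant if $X\to 1$ is a fibration and cofibrant if $0\to X$ is a cofibration. A model structure is strong if: whenever $g\circ f$ is an acyclic cofibration, $f$ is an acyclic cofibration; and whenever $g\circ f$ is an acyclic fibration, $g$ is an acyclic fibration. The bijection sends a strong model structure to the pair (set of fibrant objects, set of cofibrant objects). *)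

theory Defs
  imports Main
begin

text \<open>
  A preorder is viewed as a category whose morphism \<open>x \<rightarrow> y\<close> is the pair \<open>(x, y)\<close> with \<open>x \<le> y\<close>.
  Parallel morphisms are equal, so commutativity conditions on diagrams are omitted throughout.
\<close>

definition arrows :: "('a::preorder \<times> 'a) set" where
  "arrows = {(x, y). x \<le> y}"

definition isomorphic :: "'a::preorder \<Rightarrow> 'a \<Rightarrow> bool" where
  "isomorphic x y \<longleftrightarrow> x \<le> y \<and> y \<le> x"

text \<open>
  A functor from a finite category to a preorder factors uniquely through the preorder reflection
  of that category, and has the same cones and cocones. Hence finite diagrams may be indexed by
  finite preorders \<open>(J, r)\<close>, and \<open>J\<close> may be taken to consist of natural numbers.
\<close>

definition diagram :: "'i set \<Rightarrow> ('i \<times> 'i) set \<Rightarrow> ('i \<Rightarrow> 'a::preorder) \<Rightarrow> bool" where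
  "diagram J r d \<longleftrightarrow> preorder_on J r \<and> (\<forall>(i, j)\<in>r. d i \<le> d j)"

definition is_limit :: "'i set \<Rightarrow> ('i \<Rightarrow> 'a::preorder) \<Rightarrow> 'a \<Rightarrow> bool" where
  "is_limit J d l \<longleftrightarrow> (\<forall>j\<in>J. l \<le> d j) \<and> (\<forall>z. (\<forall>j\<in>J. z \<le> d j) \<longrightarrow> z \<le> l)"

definition is_colimit :: "'i set \<Rightarrow> ('i \<Rightarrow> 'a::preorder) \<Rightarrow> 'a \<Rightarrow> bool" where
  "is_colimit J d l \<longleftrightarrow> (\<forall>j\<in>J. d j \<le> l) \<and> (\<forall>z. (\<forall>j\<in>J. d j \<le> z) \<longrightarrow> l \<le> z)"

definition finitely_bicomplete :: "'a::preorder itself \<Rightarrow> bool" where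
  "finitely_bicomplete _ \<longleftrightarrow>
     (\<forall>(J :: nat set) r (d :: nat \<Rightarrow> 'a). finite J \<and> diagram J r d \<longrightarrow>
        (\<exists>l. is_limit J d l) \<and> (\<exists>l. is_colimit J d l))"

definition initial :: "'a::preorder \<Rightarrow> bool" where
  "initial x \<longleftrightarrow> (\<forall>y. x \<le> y)"

definition terminal :: "'a::preorder \<Rightarrow> bool" where
  "terminal x \<longleftrightarrow> (\<forall>y. y \<le> x)"

definition lifts :: "'a::preorder \<times> 'a \<Rightarrow> 'a \<times> 'a \<Rightarrow> bool" where
  "lifts f g \<longleftrightarrow> (fst f \<le> fst g \<and> snd f \<le> snd g \<longrightarrow> snd f \<le> fst g)"

definition left_lifting :: "('a::preorder \<times> 'a) set \<Rightarrow> ('a \<times> 'a) set" where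
  "left_lifting R = {f \<in> arrows. \<forall>g\<in>R. lifts f g}"

definition right_lifting :: "('a::preorder \<times> 'a) set \<Rightarrow> ('a \<times> 'a) set" where
  "right_lifting L = {g \<in> arrows. \<forall>f\<in>L. lifts f g}"

definition weak_factorization_system ::
    "('a::preorder \<times> 'a) set \<Rightarrow> ('a \<times> 'a) set \<Rightarrow> bool" where
  "weak_factorization_system L R \<longleftrightarrow>
     L \<subseteq> arrows \<and> R \<subseteq> arrows \<and>
     (\<forall>(x, y)\<in>arrows. \<exists>z. (x, z) \<in> L \<and> (z, y) \<in> R) \<and>
     L = left_lifting R \<and> R = right_lifting L"

definition wide_subcategory :: "('a::preorder \<times> 'a) set \<Rightarrow> bool" where
  "wide_subcategory S \<longleftrightarrow> S \<subseteq> arrows \<and> refl S \<and> trans S"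

text \<open>The retract relation in the arrow category: \<open>f \<rightarrow> g \<rightarrow> f\<close>, the composite being the identity.\<close>

definition retract_of :: "'a::preorder \<times> 'a \<Rightarrow> 'a \<times> 'a \<Rightarrow> bool" where
  "retract_of f g \<longleftrightarrow>
     fst f \<le> fst g \<and> snd f \<le> snd g \<and> fst g \<le> fst f \<and> snd g \<le> snd f"

definition retract_closed :: "('a::preorder \<times> 'a) set \<Rightarrow> bool" where
  "retract_closed S \<longleftrightarrow> (\<forall>f\<in>arrows. \<forall>g\<in>S. retract_of f g \<longrightarrow> f \<in> S)"

definition two_out_of_three :: "('a::preorder \<times> 'a) set \<Rightarrow> bool" where
  "two_out_of_three W \<longleftrightarrow> (\<forall>x y z. x \<le> y \<and> y \<le> z \<longrightarrow>
     ((x, y) \<in> W \<and> (y, z) \<in> W \<longrightarrow> (x, z) \<in> W) \<and>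
     ((x, y) \<in> W \<and> (x, z) \<in> W \<longrightarrow> (y, z) \<in> W) \<and>
     ((y, z) \<in> W \<and> (x, z) \<in> W \<longrightarrow> (x, y) \<in> W))"

definition model_structure ::
    "('a::preorder \<times> 'a) set \<Rightarrow> ('a \<times> 'a) set \<Rightarrow> ('a \<times> 'a) set \<Rightarrow> bool" where
  "model_structure cof we fib \<longleftrightarrow>
     (\<forall>S\<in>{cof, we, fib}. wide_subcategory S \<and> retract_closed S) \<and>
     weak_factorization_system (cof \<inter> we) fib \<and>
     weak_factorization_system cof (we \<inter> fib) \<and>
     two_out_of_three we"

definition strong_model_structure ::
    "('a::preorder \<times> 'a) set \<Rightarrow> ('a \<times> 'a) set \<Rightarrow> ('a \<times> 'a) set \<Rightarrow> bool" where
  "strong_model_structure cof we fib \<longleftrightarrow>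
     model_structure cof we fib \<and>
     (\<forall>x y z. x \<le> y \<and> y \<le> z \<and> (x, z) \<in> cof \<inter> we \<longrightarrow> (x, y) \<in> cof \<inter> we) \<and>
     (\<forall>x y z. x \<le> y \<and> y \<le> z \<and> (x, z) \<in> we \<inter> fib \<longrightarrow> (y, z) \<in> we \<inter> fib)"

text \<open>
  Terminal and initial objects are only unique up to isomorphism; since fibrations and
  cofibrations are closed under retracts, the choice does not matter.
\<close>

definition fibrant_objects :: "('a::preorder \<times> 'a) set \<Rightarrow> 'a set" where
  "fibrant_objects fib = {x. \<exists>t. terminal t \<and> (x, t) \<in> fib}"

definition cofibrant_objects :: "('a::preorder \<times> 'a) set \<Rightarrow> 'a set" where
  "cofibrant_objects cof = {x. \<exists>i. initial i \<and> (i, x) \<in> cof}"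

definition iso_closed :: "'a::preorder set \<Rightarrow> bool" where
  "iso_closed S \<longleftrightarrow> (\<forall>x\<in>S. \<forall>y. isomorphic x y \<longrightarrow> y \<in> S)"

definition upper_bounds_in :: "'a::preorder set \<Rightarrow> 'a \<Rightarrow> 'a set" where
  "upper_bounds_in S x = {y \<in> S. x \<le> y}"

definition lower_bounds_in :: "'a::preorder set \<Rightarrow> 'a \<Rightarrow> 'a set" where
  "lower_bounds_in S x = {y \<in> S. y \<le> x}"

definition least_in :: "'a::preorder set \<Rightarrow> 'a \<Rightarrow> bool" where
  "least_in S m \<longleftrightarrow> m \<in> S \<and> (\<forall>s\<in>S. m \<le> s)"

definition greatest_in :: "'a::preorder set \<Rightarrow> 'a \<Rightarrow> bool" where
  "greatest_in S m \<longleftrightarrow> m \<in> S \<and> (\<forall>s\<in>S. s \<le> m)"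

definition minimal_in :: "'a::preorder set \<Rightarrow> 'a \<Rightarrow> bool" where
  "minimal_in S m \<longleftrightarrow> m \<in> S \<and> (\<forall>s\<in>S. s \<le> m \<longrightarrow> isomorphic s m)"

definition maximal_in :: "'a::preorder set \<Rightarrow> 'a \<Rightarrow> bool" where
  "maximal_in S m \<longleftrightarrow> m \<in> S \<and> (\<forall>s\<in>S. m \<le> s \<longrightarrow> isomorphic s m)"

definition admissible :: "'a::preorder set \<Rightarrow> 'a set \<Rightarrow> bool" where
  "admissible F C \<longleftrightarrow>
     (iso_closed F \<and> iso_closed C) \<and>
     (\<forall>x. \<exists>m. least_in (upper_bounds_in F x) m) \<and>
     (\<forall>x. \<exists>m. greatest_in (lower_bounds_in C x) m) \<and>
     (\<forall>x. \<forall>f\<in>F. \<forall>c\<in>C.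
        minimal_in {g \<in> F. \<forall>l\<in>lower_bounds_in C x. l \<le> g} f \<and>
        maximal_in {d \<in> C. \<forall>u\<in>upper_bounds_in F x. d \<le> u} c \<longrightarrow> isomorphic f c) \<and>
     (\<forall>x y. (\<exists>l\<in>lower_bounds_in C y. x \<le> l) \<and> (\<exists>u\<in>upper_bounds_in F x. u \<le> y) \<longrightarrow>
        (\<exists>u\<in>upper_bounds_in F x. \<exists>l\<in>lower_bounds_in C y. u \<le> l)) \<and>
     (\<forall>a b. a \<le> b \<and> lower_bounds_in C b \<subseteq> lower_bounds_in C a \<and>
        upper_bounds_in F a \<subseteq> upper_bounds_in F b \<longrightarrow> b \<le> a)"

end

theory Submission
  imports Defs
begin

text \<open>
  Let \<open>R x\<close> be the least member of \<open>F\<close> above \<open>x\<close> and \<open>Q y\<close> the greatest member of \<open>C\<close> below \<open>y\<close>.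
  Strongness forces the acyclic cofibrations to be the maps with \<open>x \<le> y \<le> R x\<close> and the acyclic
  fibrations to be the maps with \<open>Q y \<le> x \<le> y\<close>, so the model structure is determined by
  \<open>(F, C)\<close>; its weak equivalences are the maps \<open>x \<le> y\<close> with \<open>Q y \<le> R x\<close>.
  Conversely, for an admissible pair these classes give two weak factorization systems, the
  factorizations of \<open>x \<le> y\<close> being through the meet of \<open>R x\<close> and \<open>y\<close> and through the join of \<open>x\<close> and
  \<open>Q y\<close>. Condition 6 makes acyclic cofibrations lift against acyclic fibrations. Condition 4 says
  \<open>R (Q x) \<cong> Q (R x)\<close>, so a map \<open>x \<le> y\<close> is a weak equivalence iff \<open>R (Q y) \<le> R (Q x)\<close>,
  whence two-out-of-three.
\<close>

section \<open>The classes of maps determined by two sets of objects\<close>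

definition induced_acof :: "'a::preorder set \<Rightarrow> ('a \<times> 'a) set" where
  "induced_acof F = {(x, y). x \<le> y \<and> upper_bounds_in F x \<subseteq> upper_bounds_in F y}"

definition induced_afib :: "'a::preorder set \<Rightarrow> ('a \<times> 'a) set" where
  "induced_afib C = {(x, y). x \<le> y \<and> lower_bounds_in C y \<subseteq> lower_bounds_in C x}"

definition induced_cof :: "'a::preorder set \<Rightarrow> ('a \<times> 'a) set" where
  "induced_cof C = left_lifting (induced_afib C)"

definition induced_fib :: "'a::preorder set \<Rightarrow> ('a \<times> 'a) set" where
  "induced_fib F = right_lifting (induced_acof F)"

text \<open>Quantifying over all bounds avoids a choice of replacements, which need not exist for
  arbitrary \<open>F\<close> and \<open>C\<close>. When they exist, the condition says that the
  cofibrant replacement of \<open>y\<close> lies below the fibrant replacement of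
  \<open>x\<close>.\<close>

definition induced_we :: "'a::preorder set \<Rightarrow> 'a set \<Rightarrow> ('a \<times> 'a) set" where
  "induced_we F C =
     {(x, y). x \<le> y \<and> (\<forall>c\<in>lower_bounds_in C y. \<forall>f\<in>upper_bounds_in F x. c \<le> f)}"

section \<open>Terminal and initial objects, binary meets and joins\<close>

lemma terminal_exists:
  assumes "finitely_bicomplete TYPE('a::preorder)"
  obtains t :: "'a::preorder" where "terminal t"
proof -
  \<comment> \<open>Every element is a cone over the empty diagram, so a limit of it is terminal.
    The value \<open>undefined\<close> is never looked at.\<close>
  have "diagram ({} :: nat set) {} (\<lambda>_. undefined :: 'a)"
    by (simp add: diagram_def preorder_on_def refl_on_def trans_def)
  then obtain t :: 'a where "is_limit ({} :: nat set) (\<lambda>_. undefined) t"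
    using assms unfolding finitely_bicomplete_def by (meson finite.emptyI)
  then show thesis
    using that by (auto simp: is_limit_def terminal_def)
qed

lemma initial_exists:
  assumes "finitely_bicomplete TYPE('a::preorder)"
  obtains t :: "'a::preorder" where "initial t"
proof -
  have "diagram ({} :: nat set) {} (\<lambda>_. undefined :: 'a)"
    by (simp add: diagram_def preorder_on_def refl_on_def trans_def)
  then obtain t :: 'a where "is_colimit ({} :: nat set) (\<lambda>_. undefined) t"
    using assms unfolding finitely_bicomplete_def by (meson finite.emptyI)
  then show thesis
    using that by (auto simp: is_colimit_def initial_def)
qed

text \<open>\<open>Id_on\<close> makes the two indices a discrete preorder, so a limit of this
  diagram is a meet and a colimit is a join.\<close>

lemma diagram_pair:
  fixes x y :: "'a::preorder"
  shows "diagram {0, 1 :: nat} (Id_on {0, 1}) (\<lambda>i. if i = 0 then x else y)"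
  by (auto simp: diagram_def preorder_on_def refl_on_def trans_def)

lemma meet_exists:
  fixes x y :: "'a::preorder"
  assumes "finitely_bicomplete TYPE('a)"
  obtains m where "m \<le> x" "m \<le> y" "\<And>z. z \<le> x \<Longrightarrow> z \<le> y \<Longrightarrow> z \<le> m"
proof -
  obtain m where "is_limit {0, 1 :: nat} (\<lambda>i. if i = 0 then x else y) m"
    using assms diagram_pair[of x y] unfolding finitely_bicomplete_def
    by (meson finite.emptyI finite.insertI)
  then show thesis
    by (intro that[of m]) (simp_all add: is_limit_def)
qed

lemma join_exists:
  fixes x y :: "'a::preorder"
  assumes "finitely_bicomplete TYPE('a)"
  obtains m where "x \<le> m" "y \<le> m" "\<And>z. x \<le> z \<Longrightarrow> y \<le> z \<Longrightarrow> m \<le> z"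
proof -
  obtain m where "is_colimit {0, 1 :: nat} (\<lambda>i. if i = 0 then x else y) m"
    using assms diagram_pair[of x y] unfolding finitely_bicomplete_def
    by (meson finite.emptyI finite.insertI)
  then show thesis
    by (intro that[of m]) (simp_all add: is_colimit_def)
qed

section \<open>Membership criteria and closure properties\<close>

lemma induced_acof_iff:
  assumes "least_in (upper_bounds_in F x) r"
  shows "(x, y) \<in> induced_acof F \<longleftrightarrow> x \<le> y \<and> y \<le> r"
  using assms by (auto simp: induced_acof_def upper_bounds_in_def least_in_def intro: order_trans)

lemma induced_afib_iff:
  assumes "greatest_in (lower_bounds_in C y) q"
  shows "(x, y) \<in> induced_afib C \<longleftrightarrow> x \<le> y \<and> q \<le> x"
  using assms by (auto simp: induced_afib_def lower_bounds_in_def greatest_in_def intro: order_trans)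

lemma induced_we_iff:
  assumes "least_in (upper_bounds_in F x) r" "greatest_in (lower_bounds_in C y) q"
  shows "(x, y) \<in> induced_we F C \<longleftrightarrow> x \<le> y \<and> q \<le> r"
  using assms unfolding induced_we_def least_in_def greatest_in_def
  by (auto; meson order_trans)

lemma left_lifting_iff:
  "(x, y) \<in> left_lifting S \<longleftrightarrow>
     x \<le> y \<and> (\<forall>u v. (u, v) \<in> S \<longrightarrow> x \<le> u \<longrightarrow> y \<le> v \<longrightarrow> y \<le> u)"
  by (auto simp: left_lifting_def lifts_def arrows_def)

lemma right_lifting_iff:
  "(x, y) \<in> right_lifting S \<longleftrightarrow>
     x \<le> y \<and> (\<forall>u v. (u, v) \<in> S \<longrightarrow> u \<le> x \<longrightarrow> v \<le> y \<longrightarrow> v \<le> x)"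
  by (auto simp: right_lifting_def lifts_def arrows_def)

lemma wide_subcategory_left_lifting: "wide_subcategory (left_lifting S)"
proof -
  have "trans (left_lifting S)"
    unfolding trans_def left_lifting_iff by (meson order_trans)
  then show ?thesis
    by (auto simp: wide_subcategory_def refl_on_def left_lifting_iff arrows_def)
qed

lemma wide_subcategory_right_lifting: "wide_subcategory (right_lifting S)"
proof -
  have "trans (right_lifting S)"
    unfolding trans_def right_lifting_iff by (meson order_trans)
  then show ?thesis
    by (auto simp: wide_subcategory_def refl_on_def right_lifting_iff arrows_def)
qed

lemma retract_closed_left_lifting: "retract_closed (left_lifting S)"
  unfolding retract_closed_def retract_of_def
  by (clarsimp simp: left_lifting_iff arrows_def) (meson order_trans)

lemma retract_closed_right_lifting: "retract_closed (right_lifting S)"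
  unfolding retract_closed_def retract_of_def
  by (clarsimp simp: right_lifting_iff arrows_def) (meson order_trans)

section \<open>The two weak factorization systems\<close>

lemma weak_factorization_system_induced_acof:
  fixes F :: "'a::preorder set"
  assumes bic: "finitely_bicomplete TYPE('a)"
    and F: "\<And>x. \<exists>m. least_in (upper_bounds_in F x) m"
  shows "weak_factorization_system (induced_acof F) (induced_fib F)"
proof -
  have fact: "\<exists>z. (x, z) \<in> induced_acof F \<and> (z, y) \<in> induced_fib F" if "x \<le> y" for x y
  proof -
    obtain r where r: "least_in (upper_bounds_in F x) r"
      using F by blast
    obtain z where z: "z \<le> r" "z \<le> y" "\<And>w. w \<le> r \<Longrightarrow> w \<le> y \<Longrightarrow> w \<le> z"
      using meet_exists[OF bic] by blast
    have xr: "x \<le> r" and rF: "r \<in> F"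
      using r by (auto simp: least_in_def upper_bounds_in_def)
    have "(x, z) \<in> induced_acof F"
      using induced_acof_iff[OF r] z xr that by blast
    \<comment> \<open>Since \<open>u\<close> <= \<open>z\<close> <= \<open>r\<close> and
      \<open>r\<close> lies in \<open>F\<close>, the acyclic cofibration (\<open>u\<close>,
      \<open>v\<close>) forces \<open>v\<close> <= \<open>r\<close>. Together with \<open>v\<close>
      <= \<open>y\<close> this puts \<open>v\<close> below the meet \<open>z\<close>.\<close>
    moreover have "v \<le> z" if "(u, v) \<in> induced_acof F" "u \<le> z" "v \<le> y" for u v
      using that z(1,3) rF unfolding induced_acof_def upper_bounds_in_def
      by (auto dest: order_trans)
    then have "(z, y) \<in> induced_fib F"
      using z(2) by (auto simp: induced_fib_def right_lifting_def lifts_def arrows_def)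
    ultimately show ?thesis by blast
  qed
  \<comment> \<open>Retract argument: a map that lifts against the second factor of its own
    factorization is isomorphic to the first factor.\<close>
  have "left_lifting (induced_fib F) \<subseteq> induced_acof F"
  proof clarify
    fix x y assume xy: "(x, y) \<in> left_lifting (induced_fib F)"
    then have "x \<le> y" by (simp add: left_lifting_def arrows_def)
    then obtain z where z: "(x, z) \<in> induced_acof F" "(z, y) \<in> induced_fib F"
      using fact by blast
    then have "y \<le> z"
      using xy by (fastforce simp: left_lifting_def lifts_def induced_acof_def)
    then show "(x, y) \<in> induced_acof F"
      using z(1) \<open>x \<le> y\<close> by (auto simp: induced_acof_def upper_bounds_in_def intro: order_trans)
  qed
  moreover have "induced_acof F \<subseteq> left_lifting (induced_fib F)"
    by (auto simp: left_lifting_def induced_fib_def right_lifting_def induced_acof_def arrows_def)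
  ultimately have "induced_acof F = left_lifting (induced_fib F)" by blast
  moreover have "induced_acof F \<subseteq> arrows" "induced_fib F \<subseteq> arrows"
    by (auto simp: arrows_def induced_acof_def induced_fib_def right_lifting_def)
  ultimately show ?thesis
    using fact unfolding weak_factorization_system_def
    by (auto simp: arrows_def induced_fib_def)
qed

text \<open>Order dual of the preceding argument: maps factor through the join of \<open>x\<close>
  with the greatest member \<open>q\<close> of \<open>C\<close> below \<open>y\<close>, and the
  retract argument is run for the right class.\<close>

lemma weak_factorization_system_induced_afib:
  fixes C :: "'a::preorder set"
  assumes bic: "finitely_bicomplete TYPE('a)"
    and C: "\<And>x. \<exists>m. greatest_in (lower_bounds_in C x) m"
  shows "weak_factorization_system (induced_cof C) (induced_afib C)"
proof -
  have fact: "\<exists>z. (x, z) \<in> induced_cof C \<and> (z, y) \<in> induced_afib C" if "x \<le> y" for x y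
  proof -
    obtain q where q: "greatest_in (lower_bounds_in C y) q"
      using C by blast
    obtain z where z: "q \<le> z" "x \<le> z" "\<And>w. q \<le> w \<Longrightarrow> x \<le> w \<Longrightarrow> z \<le> w"
      using join_exists[OF bic] by blast
    have qy: "q \<le> y" and qC: "q \<in> C"
      using q by (auto simp: greatest_in_def lower_bounds_in_def)
    have "(z, y) \<in> induced_afib C"
      using induced_afib_iff[OF q] z qy that by blast
    moreover have "z \<le> u" if "(u, v) \<in> induced_afib C" "x \<le> u" "z \<le> v" for u v
      using that z(1,3) qC unfolding induced_afib_def lower_bounds_in_def
      by (auto dest: order_trans)
    then have "(x, z) \<in> induced_cof C"
      using z(2) by (auto simp: induced_cof_def left_lifting_def lifts_def arrows_def)
    ultimately show ?thesis by blast
  qed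
  have "right_lifting (induced_cof C) \<subseteq> induced_afib C"
  proof clarify
    fix x y assume xy: "(x, y) \<in> right_lifting (induced_cof C)"
    then have "x \<le> y" by (simp add: right_lifting_def arrows_def)
    then obtain z where z: "(x, z) \<in> induced_cof C" "(z, y) \<in> induced_afib C"
      using fact by blast
    then have "z \<le> x"
      using xy by (fastforce simp: right_lifting_def lifts_def induced_afib_def)
    then show "(x, y) \<in> induced_afib C"
      using z(2) \<open>x \<le> y\<close> by (auto simp: induced_afib_def lower_bounds_in_def intro: order_trans)
  qed
  moreover have "induced_afib C \<subseteq> right_lifting (induced_cof C)"
    by (auto simp: right_lifting_def induced_cof_def left_lifting_def induced_afib_def arrows_def)
  ultimately have "induced_afib C = right_lifting (induced_cof C)" by blast
  moreover have "induced_afib C \<subseteq> arrows" "induced_cof C \<subseteq> arrows"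
    by (auto simp: arrows_def induced_afib_def induced_cof_def left_lifting_def)
  ultimately show ?thesis
    using fact unfolding weak_factorization_system_def
    by (auto simp: arrows_def induced_cof_def)
qed

section \<open>Consequences of admissibility\<close>

lemma admissibleD:
  assumes "admissible F C"
  shows "iso_closed F" "iso_closed C"
    and "\<exists>m. least_in (upper_bounds_in F x) m"
    and "\<exists>m. greatest_in (lower_bounds_in C x) m"
  using assms by (simp_all add: admissible_def)

text \<open>All lower bounds for \<open>x\<close> in \<open>C\<close> lie below \<open>Q x\<close>,
  so \<open>R (Q x)\<close> is even least among the candidates for f in condition 4. Dually
  \<open>Q (R x)\<close> is greatest among the candidates for c, and condition 4 applies to this
  pair.\<close>

lemma admissible_replacements:
  assumes "admissible F C"
  obtains R Q where "\<And>x. least_in (upper_bounds_in F x) (R x)"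
    "\<And>x. greatest_in (lower_bounds_in C x) (Q x)"
    "\<And>x. isomorphic (R (Q x)) (Q (R x))"
proof -
  obtain R where R: "\<And>x. least_in (upper_bounds_in F x) (R x)"
    using admissibleD(3)[OF assms] by metis
  obtain Q where Q: "\<And>x. greatest_in (lower_bounds_in C x) (Q x)"
    using admissibleD(4)[OF assms] by metis
  have "isomorphic (R (Q x)) (Q (R x))" for x
  proof -
    have Rx: "x \<le> R x" "R x \<in> F" "\<And>f. f \<in> F \<Longrightarrow> x \<le> f \<Longrightarrow> R x \<le> f" for x
      using R[of x] by (auto simp: least_in_def upper_bounds_in_def)
    have Qx: "Q x \<le> x" "Q x \<in> C" "\<And>c. c \<in> C \<Longrightarrow> c \<le> x \<Longrightarrow> c \<le> Q x" for x
      using Q[of x] by (auto simp: greatest_in_def lower_bounds_in_def)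
    have "minimal_in {g \<in> F. \<forall>l\<in>lower_bounds_in C x. l \<le> g} (R (Q x))"
      unfolding minimal_in_def isomorphic_def lower_bounds_in_def
      using Rx Qx by (auto; meson order_trans)
    moreover have "maximal_in {d \<in> C. \<forall>u\<in>upper_bounds_in F x. d \<le> u} (Q (R x))"
      unfolding maximal_in_def isomorphic_def upper_bounds_in_def
      using Rx Qx by (auto; meson order_trans)
    moreover have "\<forall>x. \<forall>f\<in>F. \<forall>c\<in>C.
        minimal_in {g \<in> F. \<forall>l\<in>lower_bounds_in C x. l \<le> g} f \<and>
        maximal_in {d \<in> C. \<forall>u\<in>upper_bounds_in F x. d \<le> u} c \<longrightarrow> isomorphic f c"
      using assms unfolding admissible_def by (elim conjE)
    ultimately show ?thesis
      using Rx(2) Qx(2) by simp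
  qed
  with R Q show thesis using that by blast
qed

text \<open>Pull the acyclic fibration \<open>u\<close> <= \<open>v\<close> back along
  \<open>y\<close> <= \<open>v\<close>, obtaining \<open>m\<close> <= \<open>y\<close> with
  \<open>m\<close> the meet of \<open>u\<close> and \<open>y\<close>. This map is an acyclic
  fibration as a pullback and an acyclic cofibration because \<open>x\<close> <= \<open>m\<close> <=
  \<open>y\<close>. Condition 6 then inverts it.\<close>

lemma induced_acof_lifts_induced_afib:
  fixes F C :: "'a::preorder set"
  assumes bic: "finitely_bicomplete TYPE('a)" and adm: "admissible F C"
    and f: "f \<in> induced_acof F" and g: "g \<in> induced_afib C"
  shows "lifts f g"
proof -
  obtain x y u v where [simp]: "f = (x, y)" "g = (u, v)"
    by fastforce
  have "y \<le> u" if "x \<le> u" "y \<le> v"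
  proof -
    obtain m where m: "m \<le> u" "m \<le> y" "\<And>z. z \<le> u \<Longrightarrow> z \<le> y \<Longrightarrow> z \<le> m"
      using meet_exists[OF bic] by blast
    have "lower_bounds_in C y \<subseteq> lower_bounds_in C m"
      using g m that by (auto simp: induced_afib_def lower_bounds_in_def dest: order_trans)
    moreover have "x \<le> m"
      using m f that by (simp add: induced_acof_def)
    then have "upper_bounds_in F m \<subseteq> upper_bounds_in F y"
      using f by (auto simp: induced_acof_def upper_bounds_in_def dest: order_trans)
    ultimately have "y \<le> m"
      using adm m(2) unfolding admissible_def by blast
    then show ?thesis using m(1) by (rule order_trans)
  qed
  then show ?thesis by (simp add: lifts_def)
qed

lemma two_out_of_three_induced_we:
  assumes "admissible F C"
  shows "two_out_of_three (induced_we F C)"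
proof -
  obtain R Q where R: "\<And>x. least_in (upper_bounds_in F x) (R x)"
    and Q: "\<And>x. greatest_in (lower_bounds_in C x) (Q x)"
    and RQ: "\<And>x. isomorphic (R (Q x)) (Q (R x))"
    using admissible_replacements[OF assms] by metis
  have Rx: "x \<le> R x" "R x \<in> F" "\<And>f. f \<in> F \<Longrightarrow> x \<le> f \<Longrightarrow> R x \<le> f" for x
    using R[of x] by (auto simp: least_in_def upper_bounds_in_def)
  have Qx: "Q x \<le> x" "Q x \<in> C" "\<And>c. c \<in> C \<Longrightarrow> c \<le> x \<Longrightarrow> c \<le> Q x" for x
    using Q[of x] by (auto simp: greatest_in_def lower_bounds_in_def)
  have R_mono: "R x \<le> R y" if "x \<le> y" for x y
    using that Rx order_trans by metis
  have Q_mono: "Q x \<le> Q y" if "x \<le> y" for x y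
    using that Qx order_trans by metis
  \<comment> \<open>A condition that mixes \<open>Q\<close> at one end with \<open>R\<close> at the
    other becomes a comparison of two values of the same map, x to \<open>R (Q x)\<close>. Condition
    4 enters the forward direction, as \<open>Q (R x)\<close> <= \<open>R (Q x)\<close>.\<close>
  have "Q y \<le> R x \<longleftrightarrow> R (Q y) \<le> R (Q x)" for x y
  proof
    assume "Q y \<le> R x"
    then have "Q y \<le> Q (R x)" using Qx by blast
    also have "\<dots> \<le> R (Q x)" using RQ by (simp add: isomorphic_def)
    finally show "R (Q y) \<le> R (Q x)" using Rx by blast
  next
    assume "R (Q y) \<le> R (Q x)"
    then have "Q y \<le> R (Q x)" using Rx(1) order_trans by blast
    also have "\<dots> \<le> R x" using Qx(1) by (rule R_mono)
    finally show "Q y \<le> R x" .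
  qed
  then have we: "(x, y) \<in> induced_we F C \<longleftrightarrow> x \<le> y \<and> R (Q y) \<le> R (Q x)" for x y
    using induced_we_iff[OF R Q] by blast
  \<comment> \<open>By monotonicity the weak equivalences are exactly the maps that x to
    \<open>R (Q x)\<close> turns into isomorphisms, and any such class has two-out-of-three.\<close>
  have "R (Q x) \<le> R (Q y)" if "x \<le> y" for x y
    using that R_mono Q_mono by blast
  then show ?thesis
    unfolding two_out_of_three_def we by (meson order_trans)
qed

text \<open>An induced weak equivalence is an acyclic cofibration followed by an acyclic fibration.
  If it is also a cofibration, it lifts against the second factor, which is therefore invertible;
  dually for fibrations. The opposite inclusions express that acyclic cofibrations lift against
  acyclic fibrations.\<close>

lemma induced_acyclic_classes:
  fixes F C :: "'a::preorder set"
  assumes bic: "finitely_bicomplete TYPE('a)" and adm: "admissible F C"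
  shows "induced_cof C \<inter> induced_we F C = induced_acof F"
    and "induced_we F C \<inter> induced_fib F = induced_afib C"
proof -
  have lift: "lifts f g" if "f \<in> induced_acof F" "g \<in> induced_afib C" for f g
    using induced_acof_lifts_induced_afib[OF bic adm that] .
  have we: "\<exists>z. (x, z) \<in> induced_acof F \<and> (z, y) \<in> induced_afib C"
    if xy: "(x, y) \<in> induced_we F C" for x y
  proof -
    obtain r q where r: "least_in (upper_bounds_in F x) r"
      and q: "greatest_in (lower_bounds_in C y) q"
      using admissibleD(3,4)[OF adm] by metis
    have "x \<le> y" "q \<le> r"
      using xy induced_we_iff[OF r q] by blast+
    moreover have "x \<le> r" "q \<le> y"
      using r q by (auto simp: least_in_def greatest_in_def upper_bounds_in_def lower_bounds_in_def)
    \<comment> \<open>The join of \<open>x\<close> and \<open>q\<close> lies below \<open>r\<close>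
      because \<open>q\<close> <= \<open>r\<close>, and below \<open>y\<close> because
      \<open>x\<close> <= \<open>y\<close>; these are the bounds required of the two
      factors.\<close>
    moreover obtain z where "x \<le> z" "q \<le> z" "\<And>w. x \<le> w \<Longrightarrow> q \<le> w \<Longrightarrow> z \<le> w"
      using join_exists[OF bic] by blast
    ultimately have "(x, z) \<in> induced_acof F" "(z, y) \<in> induced_afib C"
      by (simp_all add: induced_acof_iff[OF r] induced_afib_iff[OF q])
    then show ?thesis by blast
  qed
  have "induced_acof F \<subseteq> induced_cof C \<inter> induced_we F C"
    using lift
    by (auto simp: induced_cof_def left_lifting_def induced_acof_def induced_we_def arrows_def
        upper_bounds_in_def lower_bounds_in_def intro: order_trans)
  moreover have "induced_cof C \<inter> induced_we F C \<subseteq> induced_acof F"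
  proof clarify
    fix x y assume xy: "(x, y) \<in> induced_cof C" "(x, y) \<in> induced_we F C"
    then obtain z where z: "(x, z) \<in> induced_acof F" "(z, y) \<in> induced_afib C"
      using we by blast
    have "y \<le> z"
      using xy(1) z by (fastforce simp: induced_cof_def left_lifting_def lifts_def induced_acof_def)
    then show "(x, y) \<in> induced_acof F"
      using z(1) xy(2)
      by (auto simp: induced_acof_def induced_we_def upper_bounds_in_def intro: order_trans)
  qed
  ultimately show "induced_cof C \<inter> induced_we F C = induced_acof F" by blast
  have "induced_afib C \<subseteq> induced_we F C \<inter> induced_fib F"
    using lift
    by (auto simp: induced_fib_def right_lifting_def induced_afib_def induced_we_def arrows_def
        upper_bounds_in_def lower_bounds_in_def intro: order_trans)
  moreover have "induced_we F C \<inter> induced_fib F \<subseteq> induced_afib C"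
  proof clarify
    fix x y assume xy: "(x, y) \<in> induced_fib F" "(x, y) \<in> induced_we F C"
    then obtain z where z: "(x, z) \<in> induced_acof F" "(z, y) \<in> induced_afib C"
      using we by blast
    have "z \<le> x"
      using xy(1) z by (fastforce simp: induced_fib_def right_lifting_def lifts_def induced_afib_def)
    then show "(x, y) \<in> induced_afib C"
      using z(2) xy(2)
      by (auto simp: induced_afib_def induced_we_def lower_bounds_in_def intro: order_trans)
  qed
  ultimately show "induced_we F C \<inter> induced_fib F = induced_afib C" by blast
qed

lemma two_out_of_threeD:
  assumes "two_out_of_three W" "x \<le> y" "y \<le> z"
  shows "(x, y) \<in> W \<Longrightarrow> (y, z) \<in> W \<Longrightarrow> (x, z) \<in> W"
    and "(x, y) \<in> W \<Longrightarrow> (x, z) \<in> W \<Longrightarrow> (y, z) \<in> W"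
    and "(y, z) \<in> W \<Longrightarrow> (x, z) \<in> W \<Longrightarrow> (x, y) \<in> W"
  using assms unfolding two_out_of_three_def by metis+

text \<open>Closure under composition is the first clause of two-out-of-three, so it rests on
  condition 4.\<close>

lemma wide_subcategory_induced_we:
  assumes "admissible F C"
  shows "wide_subcategory (induced_we F C)"
proof -
  have sub: "induced_we F C \<subseteq> arrows"
    by (auto simp: induced_we_def arrows_def)
  have "trans (induced_we F C)"
  proof (rule transI)
    fix x y z assume xy: "(x, y) \<in> induced_we F C" "(y, z) \<in> induced_we F C"
    then have "x \<le> y" "y \<le> z"
      using sub by (auto simp: arrows_def)
    then show "(x, z) \<in> induced_we F C"
      using two_out_of_threeD(1)[OF two_out_of_three_induced_we[OF assms]] xy by metis
  qed
  moreover have "refl (induced_we F C)"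
    by (auto simp: refl_on_def induced_we_def upper_bounds_in_def lower_bounds_in_def
        intro: order_trans)
  ultimately show ?thesis
    using sub by (simp add: wide_subcategory_def)
qed

lemma retract_closed_induced_we: "retract_closed (induced_we F C)"
  unfolding retract_closed_def retract_of_def induced_we_def arrows_def
    upper_bounds_in_def lower_bounds_in_def
  by (clarsimp; meson order_trans)

section \<open>The strong model structure of an admissible pair\<close>

lemma strong_model_structure_induced:
  fixes F C :: "'a::preorder set"
  assumes bic: "finitely_bicomplete TYPE('a)" and adm: "admissible F C"
  shows "strong_model_structure (induced_cof C) (induced_we F C) (induced_fib F)"
proof -
  have "weak_factorization_system (induced_acof F) (induced_fib F)"
    using weak_factorization_system_induced_acof[OF bic admissibleD(3)[OF adm]] .
  moreover have "weak_factorization_system (induced_cof C) (induced_afib C)"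
    using weak_factorization_system_induced_afib[OF bic admissibleD(4)[OF adm]] .
  ultimately have "model_structure (induced_cof C) (induced_we F C) (induced_fib F)"
    unfolding model_structure_def induced_acyclic_classes[OF bic adm]
    using wide_subcategory_induced_we[OF adm] retract_closed_induced_we two_out_of_three_induced_we[OF adm]
    by (auto simp: induced_cof_def induced_fib_def wide_subcategory_left_lifting
        wide_subcategory_right_lifting retract_closed_left_lifting retract_closed_right_lifting)
  moreover have "(x, y) \<in> induced_acof F"
    if "(x, z) \<in> induced_acof F" "x \<le> y" "y \<le> z" for x y z
    using that by (auto simp: induced_acof_def upper_bounds_in_def dest: order_trans)
  moreover have "(y, z) \<in> induced_afib C"
    if "(x, z) \<in> induced_afib C" "x \<le> y" "y \<le> z" for x y z
    using that by (auto simp: induced_afib_def lower_bounds_in_def dest: order_trans)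
  ultimately show ?thesis
    unfolding strong_model_structure_def induced_acyclic_classes[OF bic adm]
    by metis
qed

text \<open>A fibrant \<open>x\<close> lifts against the map to its replacement \<open>r\<close>, so
  \<open>x\<close> and \<open>r\<close> are isomorphic and \<open>x\<close> lies in
  \<open>F\<close>. Conversely a member of \<open>F\<close> above the source of an acyclic
  cofibration is above its target by definition.\<close>

lemma fibrant_objects_induced_fib:
  fixes F :: "'a::preorder set"
  assumes bic: "finitely_bicomplete TYPE('a)"
    and iso: "iso_closed F" and F: "\<And>x. \<exists>m. least_in (upper_bounds_in F x) m"
  shows "fibrant_objects (induced_fib F) = F"
proof (intro equalityI subsetI)
  fix x assume "x \<in> fibrant_objects (induced_fib F)"
  then obtain t where t: "terminal t" "(x, t) \<in> induced_fib F"
    by (auto simp: fibrant_objects_def)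
  obtain r where r: "least_in (upper_bounds_in F x) r"
    using F by blast
  then have "x \<le> r" "r \<in> F"
    by (auto simp: least_in_def upper_bounds_in_def)
  then have "(x, r) \<in> induced_acof F"
    using induced_acof_iff[OF r] by simp
  then have "r \<le> x"
    using t by (fastforce simp: induced_fib_def right_lifting_def lifts_def terminal_def)
  then show "x \<in> F"
    using iso \<open>x \<le> r\<close> \<open>r \<in> F\<close> unfolding iso_closed_def isomorphic_def by blast
next
  fix x assume "x \<in> F"
  obtain t :: 'a where "terminal t"
    using terminal_exists[OF bic] .
  then have "(x, t) \<in> induced_fib F"
    using \<open>x \<in> F\<close>
    by (auto simp: induced_fib_def right_lifting_def lifts_def terminal_def arrows_def
        induced_acof_def upper_bounds_in_def)
  then show "x \<in> fibrant_objects (induced_fib F)"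
    using \<open>terminal t\<close> by (auto simp: fibrant_objects_def)
qed

lemma cofibrant_objects_induced_cof:
  fixes C :: "'a::preorder set"
  assumes bic: "finitely_bicomplete TYPE('a)"
    and iso: "iso_closed C" and C: "\<And>x. \<exists>m. greatest_in (lower_bounds_in C x) m"
  shows "cofibrant_objects (induced_cof C) = C"
proof (intro equalityI subsetI)
  fix x assume "x \<in> cofibrant_objects (induced_cof C)"
  then obtain i where i: "initial i" "(i, x) \<in> induced_cof C"
    by (auto simp: cofibrant_objects_def)
  obtain q where q: "greatest_in (lower_bounds_in C x) q"
    using C by blast
  then have "q \<le> x" "q \<in> C"
    by (auto simp: greatest_in_def lower_bounds_in_def)
  then have "(q, x) \<in> induced_afib C"
    using induced_afib_iff[OF q] by simp
  then have "x \<le> q"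
    using i by (fastforce simp: induced_cof_def left_lifting_def lifts_def initial_def)
  then show "x \<in> C"
    using iso \<open>q \<le> x\<close> \<open>q \<in> C\<close> unfolding iso_closed_def isomorphic_def by blast
next
  fix x assume "x \<in> C"
  obtain i :: 'a where "initial i"
    using initial_exists[OF bic] .
  then have "(i, x) \<in> induced_cof C"
    using \<open>x \<in> C\<close>
    by (auto simp: induced_cof_def left_lifting_def lifts_def initial_def arrows_def
        induced_afib_def lower_bounds_in_def)
  then show "x \<in> cofibrant_objects (induced_cof C)"
    using \<open>initial i\<close> by (auto simp: cofibrant_objects_def)
qed

section \<open>Recovering a strong model structure from its fibrant and cofibrant objects\<close>

lemma weak_factorization_systemD:
  assumes "weak_factorization_system L R"
  shows "L \<subseteq> arrows" "R \<subseteq> arrows"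
    and "x \<le> y \<Longrightarrow> \<exists>z. (x, z) \<in> L \<and> (z, y) \<in> R"
    and "L = left_lifting R" "R = right_lifting L"
    and "(x, y) \<in> L \<Longrightarrow> (u, v) \<in> R \<Longrightarrow> x \<le> u \<Longrightarrow> y \<le> v \<Longrightarrow> y \<le> u"
proof -
  show "L \<subseteq> arrows" "R \<subseteq> arrows" and L: "L = left_lifting R" and "R = right_lifting L"
    using assms unfolding weak_factorization_system_def by metis+
  show "\<exists>z. (x, z) \<in> L \<and> (z, y) \<in> R" if "x \<le> y"
  proof -
    have "(x, y) \<in> arrows" using that by (simp add: arrows_def)
    then show ?thesis
      using assms unfolding weak_factorization_system_def by blast
  qed
  show "y \<le> u" if "(x, y) \<in> L" "(u, v) \<in> R" "x \<le> u" "y \<le> v"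
  proof -
    have "(x, y) \<in> left_lifting R" using that(1) L by blast
    then show ?thesis using that(2-4) unfolding left_lifting_iff by blast
  qed
qed

text \<open>Factor the map from \<open>x\<close> to \<open>t\<close>. The first factor lifts against
  the map from any fibrant object above \<open>x\<close> to a terminal object, so the middle object
  \<open>r\<close> is least.\<close>

lemma fibrant_replacement:
  fixes t :: "'a::preorder" and L R :: "('a \<times> 'a) set"
  assumes wfs: "weak_factorization_system L R" and t: "terminal t"
  obtains r where "(x, r) \<in> L" "least_in (upper_bounds_in (fibrant_objects R) x) r"
proof -
  obtain r where r: "(x, r) \<in> L" "(r, t) \<in> R"
    using weak_factorization_systemD(3)[OF wfs, of x t] t by (auto simp: terminal_def)
  have "r \<le> f" if "f \<in> upper_bounds_in (fibrant_objects R) x" for f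
    using that weak_factorization_systemD(6)[OF wfs r(1)]
    by (auto simp: upper_bounds_in_def fibrant_objects_def terminal_def)
  moreover have "x \<le> r"
    using r(1) weak_factorization_systemD(1)[OF wfs] by (auto simp: arrows_def)
  ultimately have "least_in (upper_bounds_in (fibrant_objects R) x) r"
    using r(2) t by (auto simp: least_in_def upper_bounds_in_def fibrant_objects_def)
  then show thesis using that r(1) by blast
qed

lemma cofibrant_replacement:
  fixes i :: "'a::preorder" and L R :: "('a \<times> 'a) set"
  assumes wfs: "weak_factorization_system L R" and i: "initial i"
  obtains q where "(q, y) \<in> R" "greatest_in (lower_bounds_in (cofibrant_objects L) y) q"
proof -
  obtain q where q: "(i, q) \<in> L" "(q, y) \<in> R"
    using weak_factorization_systemD(3)[OF wfs, of i y] i by (auto simp: initial_def)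
  have "c \<le> q" if "c \<in> lower_bounds_in (cofibrant_objects L) y" for c
    using that weak_factorization_systemD(6)[OF wfs _ q(2)]
    by (auto simp: lower_bounds_in_def cofibrant_objects_def initial_def)
  moreover have "q \<le> y"
    using q(2) weak_factorization_systemD(2)[OF wfs] by (auto simp: arrows_def)
  ultimately have "greatest_in (lower_bounds_in (cofibrant_objects L) y) q"
    using q(1) i by (auto simp: greatest_in_def lower_bounds_in_def cofibrant_objects_def)
  then show thesis using that q(2) by blast
qed

text \<open>Lifting against the fibration from \<open>r\<close> to a terminal object bounds the
  target of every map of \<open>L\<close> out of \<open>x\<close> by \<open>r\<close>. Conversely,
  strongness cuts the map \<open>x\<close> <= \<open>r\<close> down to \<open>x\<close> <=
  \<open>y\<close> for any \<open>y\<close> in between.\<close>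

lemma left_class_eq_induced_acof:
  fixes t :: "'a::preorder" and L R :: "('a \<times> 'a) set"
  assumes wfs: "weak_factorization_system L R" and t: "terminal t"
    and strong: "\<And>x y z. x \<le> y \<Longrightarrow> y \<le> z \<Longrightarrow> (x, z) \<in> L \<Longrightarrow> (x, y) \<in> L"
  shows "L = induced_acof (fibrant_objects R)"
proof -
  have "(x, y) \<in> L \<longleftrightarrow> (x, y) \<in> induced_acof (fibrant_objects R)" for x y
  proof -
    obtain r where r: "(x, r) \<in> L" and least: "least_in (upper_bounds_in (fibrant_objects R) x) r"
      using fibrant_replacement[OF wfs t] .
    then obtain s where s: "terminal s" "(r, s) \<in> R" and "x \<le> r"
      by (auto simp: least_in_def upper_bounds_in_def fibrant_objects_def)
    have "y \<le> r" if "(x, y) \<in> L"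
      using weak_factorization_systemD(6)[OF wfs that s(2) \<open>x \<le> r\<close>] s(1)
      by (simp add: terminal_def)
    moreover have "x \<le> y" if "(x, y) \<in> L"
      using that weak_factorization_systemD(1)[OF wfs] by (auto simp: arrows_def)
    ultimately show ?thesis
      using induced_acof_iff[OF least, of y] strong[OF _ _ r] by blast
  qed
  then show ?thesis by auto
qed

lemma right_class_eq_induced_afib:
  fixes i :: "'a::preorder" and L R :: "('a \<times> 'a) set"
  assumes wfs: "weak_factorization_system L R" and i: "initial i"
    and strong: "\<And>x y z. x \<le> y \<Longrightarrow> y \<le> z \<Longrightarrow> (x, z) \<in> R \<Longrightarrow> (y, z) \<in> R"
  shows "R = induced_afib (cofibrant_objects L)"
proof -
  have "(x, y) \<in> R \<longleftrightarrow> (x, y) \<in> induced_afib (cofibrant_objects L)" for x y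
  proof -
    obtain q where q: "(q, y) \<in> R"
      and greatest: "greatest_in (lower_bounds_in (cofibrant_objects L) y) q"
      using cofibrant_replacement[OF wfs i] .
    then obtain j where j: "initial j" "(j, q) \<in> L" and "q \<le> y"
      by (auto simp: greatest_in_def lower_bounds_in_def cofibrant_objects_def)
    have "q \<le> x" if "(x, y) \<in> R"
      using weak_factorization_systemD(6)[OF wfs j(2) that _ \<open>q \<le> y\<close>] j(1)
      by (simp add: initial_def)
    moreover have "x \<le> y" if "(x, y) \<in> R"
      using that weak_factorization_systemD(2)[OF wfs] by (auto simp: arrows_def)
    ultimately show ?thesis
      using induced_afib_iff[OF greatest, of x] strong[OF _ _ q] by blast
  qed
  then show ?thesis by auto
qed

text \<open>This is the injectivity half of the bijection. The acyclic classes are recovered first,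
  \<open>cof\<close> and \<open>fib\<close> are lifting classes of these, and \<open>we\<close>
  consists of the composites of an acyclic cofibration with an acyclic fibration.\<close>

lemma strong_model_structure_eq_induced:
  fixes cof we fib :: "('a::preorder \<times> 'a) set"
  assumes bic: "finitely_bicomplete TYPE('a)" and str: "strong_model_structure cof we fib"
  defines "F \<equiv> fibrant_objects fib" and "C \<equiv> cofibrant_objects cof"
  shows "cof \<inter> we = induced_acof F" "we \<inter> fib = induced_afib C"
    and "cof = induced_cof C" "fib = induced_fib F" "we = induced_we F C"
proof -
  have wfs: "weak_factorization_system (cof \<inter> we) fib" "weak_factorization_system cof (we \<inter> fib)"
    and tot: "two_out_of_three we" and sub: "we \<subseteq> arrows"
    using str
    by (simp_all add: strong_model_structure_def model_structure_def wide_subcategory_def)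
  have strong:
    "\<And>x y z. x \<le> y \<Longrightarrow> y \<le> z \<Longrightarrow> (x, z) \<in> cof \<inter> we \<Longrightarrow> (x, y) \<in> cof \<inter> we"
    "\<And>x y z. x \<le> y \<Longrightarrow> y \<le> z \<Longrightarrow> (x, z) \<in> we \<inter> fib \<Longrightarrow> (y, z) \<in> we \<inter> fib"
    using str unfolding strong_model_structure_def by blast+
  obtain t i :: 'a where t: "terminal t" and i: "initial i"
    using terminal_exists[OF bic] initial_exists[OF bic] by metis
  show acof: "cof \<inter> we = induced_acof F"
    unfolding F_def by (rule left_class_eq_induced_acof[OF wfs(1) t]) (fact strong(1))
  show afib: "we \<inter> fib = induced_afib C"
    unfolding C_def by (rule right_class_eq_induced_afib[OF wfs(2) i]) (fact strong(2))
  show "cof = induced_cof C"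
    using weak_factorization_systemD(4)[OF wfs(2)] unfolding induced_cof_def afib .
  show "fib = induced_fib F"
    using weak_factorization_systemD(5)[OF wfs(1)] unfolding induced_fib_def acof .
  have "(x, y) \<in> we \<longleftrightarrow> (x, y) \<in> induced_we F C" for x y
  proof
    assume xy: "(x, y) \<in> we"
    then have "x \<le> y"
      using sub by (auto simp: arrows_def)
    then obtain z where z: "(x, z) \<in> cof \<inter> we" "(z, y) \<in> fib"
      using weak_factorization_systemD(3)[OF wfs(1)] by blast
    then have le: "x \<le> z" "z \<le> y"
      using weak_factorization_systemD(1,2)[OF wfs(1)] by (auto simp: arrows_def)
    \<comment> \<open>Two-out-of-three makes the second factor an acyclic fibration.\<close>
    then have "(z, y) \<in> we"
      using two_out_of_threeD(2)[OF tot le] xy z(1) by simp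
    then have "(x, z) \<in> induced_acof F" "(z, y) \<in> induced_afib C"
      using z acof afib by auto
    then show "(x, y) \<in> induced_we F C"
      using \<open>x \<le> y\<close> by (auto simp: induced_we_def induced_acof_def induced_afib_def
          upper_bounds_in_def lower_bounds_in_def intro: order_trans)
  next
    assume xy: "(x, y) \<in> induced_we F C"
    obtain r where r: "least_in (upper_bounds_in F x) r"
      unfolding F_def using fibrant_replacement[OF wfs(1) t] by metis
    obtain q where q: "greatest_in (lower_bounds_in C y) q"
      unfolding C_def using cofibrant_replacement[OF wfs(2) i] by metis
    have le: "x \<le> y" "q \<le> r"
      using xy induced_we_iff[OF r q] by blast+
    obtain z where z: "x \<le> z" "q \<le> z" "\<And>w. x \<le> w \<Longrightarrow> q \<le> w \<Longrightarrow> z \<le> w"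
      using join_exists[OF bic] by blast
    moreover have "x \<le> r" "q \<le> y"
      using r q by (auto simp: least_in_def greatest_in_def upper_bounds_in_def lower_bounds_in_def)
    ultimately have "(x, z) \<in> induced_acof F" "(z, y) \<in> induced_afib C" "z \<le> y"
      using le by (simp_all add: induced_acof_iff[OF r] induced_afib_iff[OF q])
    then have "(x, z) \<in> we" "(z, y) \<in> we"
      using acof afib by auto
    then show "(x, y) \<in> we"
      using two_out_of_threeD(1)[OF tot \<open>x \<le> z\<close> \<open>z \<le> y\<close>] by simp
  qed
  then show "we = induced_we F C" by auto
qed

section \<open>Admissibility of the fibrant and cofibrant objects\<close>

lemma iso_closed_fibrant_objects:
  assumes "R = right_lifting L"
  shows "iso_closed (fibrant_objects R)"
  unfolding iso_closed_def isomorphic_def fibrant_objects_def assms right_lifting_def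
    lifts_def arrows_def terminal_def
  by (auto intro: order_trans; meson order_trans)

lemma iso_closed_cofibrant_objects:
  assumes "L = left_lifting R"
  shows "iso_closed (cofibrant_objects L)"
  unfolding iso_closed_def isomorphic_def cofibrant_objects_def assms left_lifting_def
    lifts_def arrows_def initial_def
  by (auto intro: order_trans; meson order_trans)

lemma admissible_if_strong_model_structure:
  fixes cof we fib :: "('a::preorder \<times> 'a) set"
  assumes bic: "finitely_bicomplete TYPE('a)" and str: "strong_model_structure cof we fib"
  shows "admissible (fibrant_objects fib) (cofibrant_objects cof)"
proof -
  define F where "F = fibrant_objects fib"
  define C where "C = cofibrant_objects cof"
  note induced = strong_model_structure_eq_induced[OF bic str, folded F_def C_def]
  have wfs: "weak_factorization_system (cof \<inter> we) fib" "weak_factorization_system cof (we \<inter> fib)"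
    and tot: "two_out_of_three we" and "trans cof" "trans fib"
    using str
    by (simp_all add: strong_model_structure_def model_structure_def wide_subcategory_def)
  obtain t i :: 'a where t: "terminal t" and i: "initial i"
    using terminal_exists[OF bic] initial_exists[OF bic] by metis
  have iso: "iso_closed F" "iso_closed C"
    unfolding F_def C_def
    using iso_closed_fibrant_objects[OF weak_factorization_systemD(5)[OF wfs(1)]]
      iso_closed_cofibrant_objects[OF weak_factorization_systemD(4)[OF wfs(2)]] by auto
  have "\<exists>r. (x, r) \<in> cof \<inter> we \<and> least_in (upper_bounds_in F x) r" for x
    unfolding F_def using fibrant_replacement[OF wfs(1) t] by metis
  then obtain R where R_acof: "\<And>x. (x, R x) \<in> cof \<inter> we"
    and R: "\<And>x. least_in (upper_bounds_in F x) (R x)"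
    by metis
  have "\<exists>q. (q, x) \<in> we \<inter> fib \<and> greatest_in (lower_bounds_in C x) q" for x
    unfolding C_def using cofibrant_replacement[OF wfs(2) i] by metis
  then obtain Q where Q_afib: "\<And>x. (Q x, x) \<in> we \<inter> fib"
    and Q: "\<And>x. greatest_in (lower_bounds_in C x) (Q x)"
    by metis
  have Rx: "x \<le> R x" "R x \<in> F" "\<And>f. f \<in> F \<Longrightarrow> x \<le> f \<Longrightarrow> R x \<le> f" for x
    using R[of x] by (auto simp: least_in_def upper_bounds_in_def)
  have Qx: "Q x \<le> x" "Q x \<in> C" "\<And>c. c \<in> C \<Longrightarrow> c \<le> x \<Longrightarrow> c \<le> Q x" for x
    using Q[of x] by (auto simp: greatest_in_def lower_bounds_in_def)
  have lift: "y \<le> u"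
    if "(x, y) \<in> cof \<inter> we" "(u, v) \<in> we \<inter> fib" "x \<le> u" "y \<le> v" for x y u v
    using weak_factorization_systemD(6)[OF wfs(1)] that by blast
  have RQ: "isomorphic (R (Q x)) (Q (R x))" for x
  proof -
    \<comment> \<open>Composing the cofibrations from an initial object to \<open>Q x\<close> and
      from \<open>Q x\<close> to \<open>R (Q x)\<close> shows that the fibrant replacement of a
      cofibrant object stays cofibrant.\<close>
    have RQC: "R (Q x) \<in> C"
      using Qx(2)[of x] R_acof[of "Q x"] transD[OF \<open>trans cof\<close>]
      unfolding C_def cofibrant_objects_def by blast
    have QRF: "Q (R x) \<in> F"
      using Rx(2)[of x] Q_afib[of "R x"] transD[OF \<open>trans fib\<close>]
      unfolding F_def fibrant_objects_def by blast
    have le: "R (Q x) \<le> R x"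
      using Rx Qx order_trans by metis
    then have le': "R (Q x) \<le> Q (R x)"
      using Qx(3) RQC by blast
    \<comment> \<open>The composite of \<open>Q x\<close> <= \<open>x\<close> <= \<open>R x\<close>
      is a weak equivalence, and two-out-of-three carries this over to the comparison of
      \<open>R (Q x)\<close> with \<open>Q (R x)\<close>.\<close>
    have "(Q x, R x) \<in> we"
      using two_out_of_threeD(1)[OF tot Qx(1) Rx(1)] R_acof Q_afib by blast
    then have "(R (Q x), R x) \<in> we"
      using two_out_of_threeD(2)[OF tot Rx(1) le] R_acof[of "Q x"] by blast
    then have "(R (Q x), Q (R x)) \<in> we"
      using two_out_of_threeD(3)[OF tot le' Qx(1)] Q_afib[of "R x"] by blast
    then have "(R (Q x), Q (R x)) \<in> induced_we F C"
      using induced by simp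
    \<comment> \<open>Instantiate the definition of the induced weak equivalences at the ends
      themselves: \<open>Q (R x)\<close> is a lower bound for itself in \<open>C\<close>, and
      \<open>R (Q x)\<close> an upper bound for itself in \<open>F\<close>.\<close>
    then have "Q (R x) \<le> R (Q x)"
      using Rx(2) Qx(2) by (simp add: induced_we_def upper_bounds_in_def lower_bounds_in_def)
    then show ?thesis using le' by (simp add: isomorphic_def)
  qed
  have cond4: "isomorphic f c" if "f \<in> F" "c \<in> C"
    and f: "minimal_in {g \<in> F. \<forall>l\<in>lower_bounds_in C x. l \<le> g} f"
    and c: "maximal_in {d \<in> C. \<forall>u\<in>upper_bounds_in F x. d \<le> u} c" for x f c
  proof -
    \<comment> \<open>The set has \<open>R (Q x)\<close> as a least element, so its minimal element
      \<open>f\<close> is isomorphic to it; dually for \<open>c\<close> and \<open>Q (R x)\<close>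
      below.\<close>
    have "R (Q x) \<in> {g \<in> F. \<forall>l\<in>lower_bounds_in C x. l \<le> g}"
      using Rx Qx unfolding lower_bounds_in_def by (auto; meson order_trans)
    moreover have "R (Q x) \<le> f"
      using f Rx(3) Qx unfolding minimal_in_def lower_bounds_in_def by simp
    ultimately have "isomorphic (R (Q x)) f"
      using f unfolding minimal_in_def by blast
    have "Q (R x) \<in> {d \<in> C. \<forall>u\<in>upper_bounds_in F x. d \<le> u}"
      using Rx Qx unfolding upper_bounds_in_def by (auto; meson order_trans)
    moreover have "c \<le> Q (R x)"
      using c Qx(3) Rx unfolding maximal_in_def upper_bounds_in_def by simp
    ultimately have "isomorphic (Q (R x)) c"
      using c unfolding maximal_in_def by blast
    then show ?thesis
      using \<open>isomorphic (R (Q x)) f\<close> RQ[of x] unfolding isomorphic_def by (meson order_trans)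
  qed
  have cond5: "\<exists>u\<in>upper_bounds_in F x. \<exists>l\<in>lower_bounds_in C y. u \<le> l"
    if "l \<in> lower_bounds_in C y" "x \<le> l" "u \<in> upper_bounds_in F x" "u \<le> y" for x y l u
  proof -
    \<comment> \<open>These inequalities form a square from the acyclic cofibration \<open>x\<close>
      <= \<open>R x\<close> to the acyclic fibration \<open>Q y\<close> <= \<open>y\<close>. Its
      lift is the conclusion of condition 5.\<close>
    have "x \<le> Q y" "R x \<le> y"
      using that Qx(3) Rx(3) unfolding upper_bounds_in_def lower_bounds_in_def
      by (blast intro: order_trans)+
    then have "R x \<le> Q y"
      using lift R_acof Q_afib by blast
    then show ?thesis
      using Rx Qx unfolding upper_bounds_in_def lower_bounds_in_def by blast
  qed
  \<comment> \<open>The map is both an acyclic cofibration and an acyclic fibration, so it lifts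
    against itself.\<close>
  have cond6: "b \<le> a" if "a \<le> b" "lower_bounds_in C b \<subseteq> lower_bounds_in C a"
    "upper_bounds_in F a \<subseteq> upper_bounds_in F b" for a b
  proof (rule lift)
    show "(a, b) \<in> cof \<inter> we" "(a, b) \<in> we \<inter> fib"
      using that unfolding induced(1,2) by (auto simp: induced_acof_def induced_afib_def)
  qed auto
  have "admissible F C"
    unfolding admissible_def
  proof (intro conjI allI ballI impI)
    show "\<exists>m. least_in (upper_bounds_in F x) m" for x
      using R by blast
    show "\<exists>m. greatest_in (lower_bounds_in C x) m" for x
      using Q by blast
  qed (use iso cond6 in \<open>auto intro: cond4 cond5\<close>)
  then show ?thesis
    unfolding F_def C_def .
qed

theorem corollary4:
  fixes F C :: "'a::preorder set"
  assumes "finitely_bicomplete TYPE('a)"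
  shows "((\<exists>cof we fib. strong_model_structure cof we fib \<and>
             fibrant_objects fib = F \<and> cofibrant_objects cof = C)
          \<longleftrightarrow> admissible F C) \<and>
         bij_betw (\<lambda>(cof, we, fib). (fibrant_objects fib, cofibrant_objects cof))
           {(cof :: ('a \<times> 'a) set, we, fib). strong_model_structure cof we fib}
           {(F' :: 'a set, C'). admissible F' C'}"
proof
  have realized: "strong_model_structure (induced_cof C) (induced_we F C) (induced_fib F)"
    "fibrant_objects (induced_fib F) = F" "cofibrant_objects (induced_cof C) = C"
    if "admissible F C" for F C :: "'a set"
    using strong_model_structure_induced[OF assms that]
      fibrant_objects_induced_fib[OF assms admissibleD(1,3)[OF that]]
      cofibrant_objects_induced_cof[OF assms admissibleD(2,4)[OF that]] .
  note admissible = admissible_if_strong_model_structure[OF assms]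
  show "(\<exists>cof we fib. strong_model_structure cof we fib \<and>
           fibrant_objects fib = F \<and> cofibrant_objects cof = C) \<longleftrightarrow> admissible F C"
  proof
    assume "\<exists>cof we fib. strong_model_structure cof we fib \<and>
      fibrant_objects fib = F \<and> cofibrant_objects cof = C"
    then show "admissible F C"
      by (elim exE conjE) (metis admissible)
  next
    assume "admissible F C"
    from realized[OF this] show "\<exists>cof we fib. strong_model_structure cof we fib \<and>
      fibrant_objects fib = F \<and> cofibrant_objects cof = C"
      by (intro exI conjI)
  qed
  show "bij_betw (\<lambda>(cof, we, fib). (fibrant_objects fib, cofibrant_objects cof))
          {(cof :: ('a \<times> 'a) set, we, fib). strong_model_structure cof we fib}
          {(F' :: 'a set, C'). admissible F' C'}"
  \<comment> \<open>The inverse sends a pair to its induced model structure. That it is a left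
    inverse is the recovery of a strong model structure from its objects; that it is a right inverse
    is \<open>realized\<close>.\<close>
  proof (rule bij_betw_byWitness[where f' =
        "\<lambda>(F, C). (induced_cof C, induced_we F C, induced_fib F)"])
    show "\<forall>s\<in>{(cof :: ('a \<times> 'a) set, we, fib). strong_model_structure cof we fib}.
        (\<lambda>(F, C). (induced_cof C, induced_we F C, induced_fib F))
          ((\<lambda>(cof, we, fib). (fibrant_objects fib, cofibrant_objects cof)) s) = s"
      by (auto simp flip: strong_model_structure_eq_induced(3-5)[OF assms])
  qed (auto simp: realized intro: admissible)
qed

end
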